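(* Let $1\le p<\infty$. For every $\varepsilon>0$ and every pair $(F,G)\in(BV_p[0,1])^2$ there exists a pair of jointly nondegenerate functions $(F_1,G_1)\in(BV_p[0,1])^2$ such that $F\cdot G=F_1\cdot G_1$ (pointwise on $[0,1]$), $\|F-F_1\|_{BV_p}<\varepsilon$ and $\|G-G_1\|_{BV_p}<\varepsilon$.
   Context: For $1\le p<\infty$ and $f:[0,1]\to\mathbb F$, $\mathbb F\in\{\mathbb R,\mathbb C\}$, $\operatorname{Var}_p(f,[0,1]):=\sup\sum_{j=1}^m|f(t_j)-f(t_{j-1})|^p$ over all partitions $0=t_0<\dots<t_m=1$. $BV_p[0,1]$ is the set of $f$ with $\operatorname{Var}_p(f,[0,1])<\infty$, normed by $\|f\|_{BV_p}=\sup_{x\in[0,1]}|f(x)|+(\operatorname{Var}_p(f,[0,1]))^{1/p}$. Functions $F_1,G_1:[0,1]\to\mathbb F$ are jointly nondegenerate if $\inf_{x\in[0,1]}(|F_1(x)|+|G_1(x)|)>0$. *)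

theory Defs
  imports "HOL-Analysis.Analysis"
begin

definition partition01 :: "real list \<Rightarrow> bool" where
  "partition01 ts \<longleftrightarrow> length ts \<ge> 2 \<and> sorted_wrt (<) ts \<and> hd ts = 0 \<and> last ts = 1"

definition pvar :: "real \<Rightarrow> (real \<Rightarrow> 'a::real_normed_vector) \<Rightarrow> ereal" where
  "pvar p f = (SUP ts \<in> {ts. partition01 ts}.
      ereal (\<Sum>j\<in>{1..<length ts}. norm (f (ts ! j) - f (ts ! (j - 1))) powr p))"

definition BVp :: "real \<Rightarrow> (real \<Rightarrow> 'a::real_normed_vector) set" where
  "BVp p = {f. pvar p f < \<infinity>}"

definition bvp_norm :: "real \<Rightarrow> (real \<Rightarrow> 'a::real_normed_vector) \<Rightarrow> real" where
  "bvp_norm p f = (SUP x \<in> {0..1}. norm (f x)) + (real_of_ereal (pvar p f)) powr (1 / p)"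

definition jointly_nondegenerate :: "(real \<Rightarrow> 'a::real_normed_vector) \<Rightarrow> (real \<Rightarrow> 'a) \<Rightarrow> bool" where
  "jointly_nondegenerate F G \<longleftrightarrow> (INF x \<in> {0..1}. norm (F x) + norm (G x)) > 0"

end

theory Submission
  imports Defs
begin

text \<open>
  Put \<open>f = (F, G)\<close>. The part of the \<open>p\<close>-variation of \<open>f\<close> that is collected within distance \<open>\<delta>\<close> of the
  origin tends to 0 as \<open>\<delta> \<rightarrow> 0\<close>: inserting a chain of points with small values between the points
  of a nearly optimal partition does not destroy the original sum (once increments are capped, so
  that passing through the origin costs nothing), hence what the chain adds is bounded by the
  defect of optimality.

  In particular the number \<open>N\<close> of crossings of \<open>|f|\<close> between \<open>\<delta> / 2\<close> and \<open>\<delta>\<close> satisfies that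
  \<open>N \<delta>\<^sup>p\<close> is small. Let \<open>C\<close> be the set of points where \<open>|f|\<close> was below \<open>\<delta> / 2\<close> more recently than it was
  above \<open>\<delta>\<close>. On \<open>C\<close> replace \<open>(F, G)\<close> by \<open>(F G / \<delta>, \<delta>)\<close>, and leave the pair unchanged elsewhere, where
  \<open>|f| \<ge> \<delta> / 2\<close>. The change is of size \<open>O(\<delta>)\<close>; its \<open>p\<close>-variation comes from increments of \<open>f\<close> near the
  origin and from at most \<open>N + 1\<close> jumps of size \<open>O(\<delta>)\<close> at the boundary of \<open>C\<close>.
\<close>

section \<open>Sums over consecutive pairs of a list\<close>

text \<open>Keeping \<open>g\<close> arbitrary lets the same rules serve \<open>p\<close>-th powers
  of increments, their capped and near-zero variants, and the count of boundary switches.\<close>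

fun chain_sum :: "('b \<Rightarrow> 'b \<Rightarrow> real) \<Rightarrow> 'b list \<Rightarrow> real" where
  "chain_sum g [] = 0"
| "chain_sum g [x] = 0"
| "chain_sum g (x # y # ts) = g x y + chain_sum g (y # ts)"

lemma chain_sum_Cons: "ts \<noteq> [] \<Longrightarrow> chain_sum g (x # ts) = g x (hd ts) + chain_sum g ts"
  by (cases ts) auto

lemma chain_sum_append:
  "xs \<noteq> [] \<Longrightarrow> ys \<noteq> [] \<Longrightarrow>
     chain_sum g (xs @ ys) = chain_sum g xs + g (last xs) (hd ys) + chain_sum g ys"
proof (induction xs)
  case (Cons x xs)
  show ?case
  proof (cases "xs = []")
    case True
    then show ?thesis using Cons.prems by (simp add: chain_sum_Cons)
  next
    case False
    then show ?thesis using Cons by (simp add: chain_sum_Cons)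
  qed
qed simp

lemma chain_sum_append_le:
  assumes "\<And>x y. g x y \<le> c" "0 \<le> c"
  shows "chain_sum g (xs @ ys) \<le> chain_sum g xs + chain_sum g ys + c"
proof (cases "xs = [] \<or> ys = []")
  case True
  then show ?thesis using assms by auto
next
  case False
  then show ?thesis using assms(1)[of "last xs" "hd ys"] by (simp add: chain_sum_append)
qed

lemma chain_sum_append_ge:
  assumes "\<And>x y. 0 \<le> g x y"
  shows "chain_sum g xs + chain_sum g ys \<le> chain_sum g (xs @ ys)"
proof (cases "xs = [] \<or> ys = []")
  case True
  then show ?thesis by auto
next
  case False
  then show ?thesis using assms[of "last xs" "hd ys"] by (simp add: chain_sum_append)
qed

lemma chain_sum_mono:
  assumes "\<And>x y. x \<in> set ts \<Longrightarrow> y \<in> set ts \<Longrightarrow> g x y \<le> h x y"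
  shows "chain_sum g ts \<le> chain_sum h ts"
  using assms
proof (induction g ts rule: chain_sum.induct)
  case (3 g x y ts)
  have "chain_sum g (y # ts) \<le> chain_sum h (y # ts)"
    by (rule 3) (use "3.prems" in auto)
  moreover have "g x y \<le> h x y" using "3.prems" by auto
  ultimately show ?case by simp
qed auto

lemma chain_sum_cmult: "chain_sum (\<lambda>x y. c * g x y) ts = c * chain_sum g ts"
  by (induction g ts rule: chain_sum.induct) (auto simp: algebra_simps)

lemma chain_sum_add: "chain_sum (\<lambda>x y. g x y + h x y) ts = chain_sum g ts + chain_sum h ts"
  by (induction g ts rule: chain_sum.induct) auto

lemma chain_sum_remdups_adj:
  assumes "\<And>x. g x x = 0"
  shows "chain_sum g (remdups_adj ts) = chain_sum g ts"
proof (induction ts rule: remdups_adj.induct)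
  case (3 x y xs)
  then show ?case using assms by (auto simp: chain_sum_Cons)
qed auto

lemma sum_consecutive_eq_chain_sum:
  "(\<Sum>j\<in>{1..<length ts}. g (ts ! (j - 1)) (ts ! j)) = chain_sum g ts"
proof (induction g ts rule: chain_sum.induct)
  case (3 g x y ts)
  have "(\<Sum>j\<in>{1..<length (x # y # ts)}. g ((x # y # ts) ! (j - 1)) ((x # y # ts) ! j))
      = g x y + (\<Sum>j\<in>{Suc 1..<Suc (length (y # ts))}. g ((x # y # ts) ! (j - 1)) ((x # y # ts) ! j))"
    by (subst sum.atLeast_Suc_lessThan) auto
  also have "(\<Sum>j\<in>{Suc 1..<Suc (length (y # ts))}. g ((x # y # ts) ! (j - 1)) ((x # y # ts) ! j))
      = (\<Sum>j\<in>{1..<length (y # ts)}. g ((x # y # ts) ! j) ((x # y # ts) ! Suc j))"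
    by (subst sum.shift_bounds_Suc_ivl) simp
  also have "\<dots> = (\<Sum>j\<in>{1..<length (y # ts)}. g ((y # ts) ! (j - 1)) ((y # ts) ! j))"
    by (rule sum.cong) (auto simp: nth_Cons')
  also have "\<dots> = chain_sum g (y # ts)" by (rule 3)
  finally show ?case by simp
qed auto

section \<open>The \<open>p\<close>-variation in terms of sorted lists\<close>

definition incr_powr :: "real \<Rightarrow> (real \<Rightarrow> 'a::real_normed_vector) \<Rightarrow> real \<Rightarrow> real \<Rightarrow> real" where
  "incr_powr p f s t = norm (f t - f s) powr p"

lemma pvar_chain_sum: "pvar p f = (SUP ts \<in> {ts. partition01 ts}. ereal (chain_sum (incr_powr p f) ts))"
  unfolding pvar_def sum_consecutive_eq_chain_sum[symmetric] incr_powr_def ..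

lemma partition01_sorted:
  assumes "partition01 ts"
  shows "sorted ts" "set ts \<subseteq> {0..1}"
proof -
  have ne: "ts \<noteq> []" and sw: "sorted_wrt (<) ts" and h: "hd ts = 0" "last ts = 1"
    using assms by (auto simp: partition01_def)
  show s: "sorted ts" using sw strict_sorted_iff by blast
  show "set ts \<subseteq> {0..1}"
  proof
    fix x assume x: "x \<in> set ts"
    obtain us where us: "ts = 0 # us" using ne h by (cases ts) auto
    obtain vs where vs: "ts = vs @ [1]" using ne h by (metis append_butlast_last_id)
    have "0 \<le> x" using s x us by auto
    moreover have "x \<le> 1" using s x unfolding vs by (auto simp: sorted_append)
    ultimately show "x \<in> {0..1}" by simp
  qed
qed

lemma pvar_le:
  assumes "\<And>ts. sorted ts \<Longrightarrow> set ts \<subseteq> {0..1} \<Longrightarrow> chain_sum (incr_powr p f) ts \<le> V"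
  shows "pvar p f \<le> ereal V"
  unfolding pvar_chain_sum by (rule SUP_least) (use assms partition01_sorted in auto)

lemma sorted_wrt_less_remdups_adj:
  fixes ts :: "'b::linorder list"
  shows "sorted ts \<Longrightarrow> sorted_wrt (<) (remdups_adj ts)"
  by (induction ts rule: remdups_adj.induct) (auto simp: less_le)

text \<open>Adjoining 0 and 1 adds only nonnegative terms, and deleting adjacent repetitions removes
  only zero terms; the result is a partition. Partitions may thus be replaced by sorted lists, which
  can be split anywhere and may be empty.\<close>

lemma chain_sum_le_pvar:
  assumes "sorted ts" "set ts \<subseteq> {0..1}"
  shows "ereal (chain_sum (incr_powr p f) ts) \<le> pvar p f"
proof -
  let ?us = "0 # ts @ [1]"
  let ?vs = "remdups_adj ?us"
  have "sorted ?us" using assms by (auto simp: sorted_append)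
  then have "sorted_wrt (<) ?vs"
    by (rule sorted_wrt_less_remdups_adj)
  moreover have "hd ?vs = 0" "last ?vs = 1"
    by (simp_all del: remdups_adj.simps)
  moreover from this have "length ?vs \<ge> 2"
    by (cases ?vs; cases "tl ?vs") (auto simp del: remdups_adj.simps)
  ultimately have "partition01 ?vs" by (simp add: partition01_def)
  then have "ereal (chain_sum (incr_powr p f) ?vs) \<le> pvar p f"
    unfolding pvar_chain_sum by (intro SUP_upper) auto
  moreover have "chain_sum (incr_powr p f) ?vs = chain_sum (incr_powr p f) ?us"
    by (rule chain_sum_remdups_adj) (simp add: incr_powr_def)
  moreover have "chain_sum (incr_powr p f) ts \<le> chain_sum (incr_powr p f) ?us"
    using chain_sum_append_ge[of "incr_powr p f" "[0]" "ts @ [1]"]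
      chain_sum_append_ge[of "incr_powr p f" ts "[1]"]
    by (simp add: incr_powr_def)
  ultimately show ?thesis by (simp add: order_trans[rotated])
qed

lemma pvar_nonneg: "0 \<le> pvar p f"
  using chain_sum_le_pvar[of "[]" p f] by (simp add: zero_ereal_def)

lemma BVp_iff:
  "f \<in> BVp p \<longleftrightarrow>
    (\<exists>V. \<forall>ts. sorted ts \<longrightarrow> set ts \<subseteq> {0..1} \<longrightarrow> chain_sum (incr_powr p f) ts \<le> V)"
proof
  assume "f \<in> BVp p"
  then have "pvar p f < \<infinity>" by (simp add: BVp_def)
  then obtain V where "pvar p f = ereal V"
    using pvar_nonneg[of p f] by (cases "pvar p f") auto
  then show "\<exists>V. \<forall>ts. sorted ts \<longrightarrow> set ts \<subseteq> {0..1} \<longrightarrow> chain_sum (incr_powr p f) ts \<le> V"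
    using chain_sum_le_pvar[of _ p f] by (metis ereal_less_eq(3))
next
  assume "\<exists>V. \<forall>ts. sorted ts \<longrightarrow> set ts \<subseteq> {0..1} \<longrightarrow> chain_sum (incr_powr p f) ts \<le> V"
  then obtain V where "pvar p f \<le> ereal V" using pvar_le by blast
  then show "f \<in> BVp p" by (auto simp: BVp_def intro: le_less_trans)
qed

lemma powr_add_le:
  fixes a b p :: real
  assumes "0 \<le> a" "0 \<le> b" "0 \<le> p"
  shows "(a + b) powr p \<le> 2 powr p * (a powr p + b powr p)"
proof -
  have "(a + b) powr p \<le> (2 * max a b) powr p"
    by (rule powr_mono2) (use assms in auto)
  also have "\<dots> = 2 powr p * max a b powr p"
    using assms by (simp add: powr_mult)
  also have "\<dots> \<le> 2 powr p * (a powr p + b powr p)"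
    by (intro mult_left_mono) (auto simp: max_def)
  finally show ?thesis .
qed

text \<open>Serves both to combine \<open>F\<close> and \<open>G\<close> into one function with
  values in the product space and to subtract the corrections at the end.\<close>

lemma BVp_dominated:
  assumes "0 \<le> p" "f \<in> BVp p" "g \<in> BVp p"
    and h: "\<And>s t. norm (h t - h s) \<le> norm (f t - f s) + norm (g t - g s)"
  shows "h \<in> BVp p"
proof -
  obtain V W where V: "\<And>ts. sorted ts \<Longrightarrow> set ts \<subseteq> {0..1} \<Longrightarrow> chain_sum (incr_powr p f) ts \<le> V"
    and W: "\<And>ts. sorted ts \<Longrightarrow> set ts \<subseteq> {0..1} \<Longrightarrow> chain_sum (incr_powr p g) ts \<le> W"
    using assms(2,3) unfolding BVp_iff by blast
  have "chain_sum (incr_powr p h) ts \<le> 2 powr p * (V + W)" if "sorted ts" "set ts \<subseteq> {0..1}" for ts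
  proof -
    have "incr_powr p h s t \<le> 2 powr p * (incr_powr p f s t + incr_powr p g s t)" for s t
    proof -
      have "incr_powr p h s t \<le> (norm (f t - f s) + norm (g t - g s)) powr p"
        unfolding incr_powr_def by (rule powr_mono2) (use assms in auto)
      also have "\<dots> \<le> 2 powr p * (incr_powr p f s t + incr_powr p g s t)"
        unfolding incr_powr_def by (rule powr_add_le) (use assms in auto)
      finally show ?thesis .
    qed
    then have "chain_sum (incr_powr p h) ts
        \<le> chain_sum (\<lambda>s t. 2 powr p * (incr_powr p f s t + incr_powr p g s t)) ts"
      by (intro chain_sum_mono)
    also have "\<dots> = 2 powr p * (chain_sum (incr_powr p f) ts + chain_sum (incr_powr p g) ts)"
      by (simp add: chain_sum_cmult chain_sum_add)
    also have "\<dots> \<le> 2 powr p * (V + W)"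
      using V[OF that] W[OF that] by (intro mult_left_mono) auto
    finally show ?thesis .
  qed
  then show ?thesis unfolding BVp_iff by blast
qed

section \<open>Variation collected near the origin\<close>

text \<open>
  Unlike the \<open>p\<close>-th power of the increment itself, its capped version does not decrease when a
  zero of \<open>f\<close> is inserted between \<open>s\<close> and \<open>t\<close>, and it is still comparable to that power.
\<close>

definition capped_incr ::
    "real \<Rightarrow> (real \<Rightarrow> 'a::real_normed_vector) \<Rightarrow> real \<Rightarrow> real \<Rightarrow> real" where
  "capped_incr p f s t = min (norm (f t - f s) powr p) (norm (f s) powr p + norm (f t) powr p)"

text \<open>The truncation at \<open>\<delta>\<close> bounds each term by
  \<open>\<delta> powr p\<close>, so that a junction between two lists costs nothing in the
  limit.\<close>

definition near_zero_incr ::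
    "real \<Rightarrow> (real \<Rightarrow> 'a::real_normed_vector) \<Rightarrow> real \<Rightarrow> real \<Rightarrow> real \<Rightarrow> real" where
  "near_zero_incr p f \<delta> s t =
    (if norm (f s) \<le> \<delta> \<or> norm (f t) \<le> \<delta> then min \<delta> (norm (f t - f s)) powr p else 0)"

lemma near_zero_incr_nonneg: "0 \<le> near_zero_incr p f \<delta> s t"
  by (simp add: near_zero_incr_def)

lemma near_zero_incr_le:
  assumes "0 \<le> p" "0 < \<delta>"
  shows "near_zero_incr p f \<delta> s t \<le> \<delta> powr p"
  using assms by (auto simp: near_zero_incr_def intro!: powr_mono2)

lemma capped_incr_nonneg: "0 \<le> capped_incr p f s t"
  by (simp add: capped_incr_def)

text \<open>By the triangle inequality, capping an increment shrinks its \<open>p\<close>-th power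
  by a factor of at most \<open>2 powr p\<close>.\<close>

lemma near_zero_incr_le_capped_incr:
  assumes "0 \<le> p" "0 < \<delta>"
  shows "near_zero_incr p f \<delta> s t \<le> 2 powr p * capped_incr p f s t"
proof -
  let ?u = "norm (f s)" and ?v = "norm (f t)" and ?w = "norm (f t - f s)"
  have "near_zero_incr p f \<delta> s t \<le> ?w powr p"
    using assms by (auto simp: near_zero_incr_def intro!: powr_mono2)
  moreover have "1 * ?w powr p \<le> 2 powr p * ?w powr p"
    using assms by (intro mult_right_mono) (auto simp: ge_one_powr_ge_zero)
  moreover have "?w powr p \<le> (?u + ?v) powr p"
    using assms norm_triangle_ineq4[of "f t" "f s"] by (intro powr_mono2) auto
  moreover have "(?u + ?v) powr p \<le> 2 powr p * (?u powr p + ?v powr p)"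
    by (rule powr_add_le) (use assms in auto)
  ultimately show ?thesis
    by (auto simp: capped_incr_def min_def)
qed

lemma sorted_split_at:
  fixes ts :: "real list"
  assumes "sorted ts"
  obtains us vs where "ts = us @ vs" "\<And>x. x \<in> set us \<Longrightarrow> x \<le> b" "\<And>x. x \<in> set vs \<Longrightarrow> b \<le> x"
  using assms
proof (induction ts arbitrary: thesis)
  case Nil
  show ?case by (rule Nil.prems(1)[of "[]" "[]"]) auto
next
  case (Cons t ts)
  show ?case
  proof (cases "t \<le> b")
    case True
    obtain us vs where "ts = us @ vs" "\<And>x. x \<in> set us \<Longrightarrow> x \<le> b" "\<And>x. x \<in> set vs \<Longrightarrow> b \<le> x"
      using Cons.IH Cons.prems(2) by auto
    then show ?thesis using True by (intro Cons.prems(1)[of "t # us" vs]) auto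
  next
    case False
    then show ?thesis using Cons.prems(2) by (intro Cons.prems(1)[of "[]" "t # ts"]) auto
  qed
qed

text \<open>Says that \<open>v\<close> bounds the upper limit, as \<open>\<delta>\<close> decreases
  to 0, of the supremum of the near-zero sums over \<open>[a, b]\<close>.\<close>

definition near_zero_limit_le ::
    "real \<Rightarrow> (real \<Rightarrow> 'a::real_normed_vector) \<Rightarrow> real \<Rightarrow> real \<Rightarrow> real \<Rightarrow> bool" where
  "near_zero_limit_le p f a b v \<longleftrightarrow>
    (\<forall>\<kappa>>0. \<forall>\<^sub>F \<delta> in at_right 0. \<forall>ts. sorted ts \<longrightarrow> set ts \<subseteq> {a..b} \<longrightarrow>
        chain_sum (near_zero_incr p f \<delta>) ts \<le> v + \<kappa>)"

lemma eventually_powr_less: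
  fixes p \<kappa> :: real
  assumes "0 < p" "0 < \<kappa>"
  shows "\<forall>\<^sub>F \<delta> in at_right 0. \<delta> powr p < \<kappa>"
proof -
  have "((\<lambda>\<delta>. \<delta> powr p) \<longlongrightarrow> 0 powr p) (at_right (0::real))"
    by (rule tendsto_powr') (use assms in \<open>auto intro!: tendsto_eq_intros simp: eventually_at_right_less eventually_mono[OF eventually_at_right_less]\<close>)
  then show ?thesis using assms by (auto dest: order_tendstoD(2))
qed

text \<open>Splitting a list at \<open>b\<close> loses only the junction pair, whose term is at most
  \<open>\<delta> powr p\<close> and vanishes in the limit.\<close>

lemma near_zero_limit_le_join:
  assumes p: "0 < p" and v: "near_zero_limit_le p f a b v" and w: "near_zero_limit_le p f b c w"
  shows "near_zero_limit_le p f a c (v + w)"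
  unfolding near_zero_limit_le_def
proof (intro allI impI)
  fix \<kappa> :: real assume \<kappa>: "\<kappa> > 0"
  then have 3: "\<kappa> / 3 > 0" by simp
  show "\<forall>\<^sub>F \<delta> in at_right 0. \<forall>ts. sorted ts \<longrightarrow> set ts \<subseteq> {a..c} \<longrightarrow>
        chain_sum (near_zero_incr p f \<delta>) ts \<le> v + w + \<kappa>"
    using v[unfolded near_zero_limit_le_def, rule_format, OF 3]
      w[unfolded near_zero_limit_le_def, rule_format, OF 3]
      eventually_powr_less[OF p 3] eventually_at_right_less[of 0]
  proof eventually_elim
    case (elim \<delta>)
    show ?case
    proof (intro allI impI)
      fix ts :: "real list" assume ts: "sorted ts" "set ts \<subseteq> {a..c}"
      obtain us vs where s: "ts = us @ vs" "\<And>x. x \<in> set us \<Longrightarrow> x \<le> b" "\<And>x. x \<in> set vs \<Longrightarrow> b \<le> x"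
        using sorted_split_at[OF ts(1), of b] by blast
      have "sorted us" "sorted vs" "set us \<subseteq> {a..b}" "set vs \<subseteq> {b..c}"
        using ts s by (auto simp: sorted_append)
      then have "chain_sum (near_zero_incr p f \<delta>) us \<le> v + \<kappa> / 3"
        "chain_sum (near_zero_incr p f \<delta>) vs \<le> w + \<kappa> / 3"
        using elim by blast+
      moreover have "chain_sum (near_zero_incr p f \<delta>) ts \<le> chain_sum (near_zero_incr p f \<delta>) us
          + chain_sum (near_zero_incr p f \<delta>) vs + \<delta> powr p"
        unfolding s by (rule chain_sum_append_le)
            (use near_zero_incr_le[OF less_imp_le[OF p] \<open>0 < \<delta>\<close>] in auto)
      ultimately show "chain_sum (near_zero_incr p f \<delta>) ts \<le> v + w + \<kappa>"
        using elim by linarith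
    qed
  qed
qed

text \<open>As \<open>v\<close> tends to 0, the first argument of the minimum tends to
  \<open>norm u powr p\<close>, while the second is never smaller than that. So a step from
  \<open>u\<close> into a small ball about the origin collects nearly all of
  \<open>norm u powr p\<close>.\<close>

lemma eventually_capped_powr_ge:
  fixes u :: "'a::real_normed_vector" and p \<kappa> :: real
  assumes "0 < p" "0 < \<kappa>"
  shows "\<forall>\<^sub>F \<delta> in at_right 0. \<forall>v::'a. norm v \<le> \<delta> \<longrightarrow>
           norm u powr p - \<kappa> \<le> min (norm (v - u) powr p) (norm u powr p + norm v powr p)"
proof -
  \<comment> \<open>The reverse triangle inequality supplies \<open>norm u - \<delta>\<close>; the
    maximum keeps the base of the power nonnegative.\<close>
  have "((\<lambda>\<delta>. max 0 (norm u - \<delta>) powr p) \<longlongrightarrow> norm u powr p) (at_right 0)"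
    by (rule tendsto_powr') (use assms in \<open>auto intro!: tendsto_eq_intros\<close>)
  then have "\<forall>\<^sub>F \<delta> in at_right 0. norm u powr p - \<kappa> < max 0 (norm u - \<delta>) powr p"
    by (rule order_tendstoD(1)) (use assms in simp)
  then show ?thesis
  proof eventually_elim
    case (elim \<delta>)
    show ?case
    proof (intro allI impI)
      fix v :: 'a assume v: "norm v \<le> \<delta>"
      have "max 0 (norm u - \<delta>) \<le> norm (v - u)"
        using v norm_triangle_ineq2[of u v] by (auto simp: norm_minus_commute)
      then have "max 0 (norm u - \<delta>) powr p \<le> norm (v - u) powr p"
        using assms by (intro powr_mono2) auto
      moreover have "norm u powr p - \<kappa> \<le> norm u powr p + norm v powr p"
        using assms powr_ge_zero[of "norm v" p] by linarith
      ultimately show "norm u powr p - \<kappa> \<le> min (norm (v - u) powr p) (norm u powr p + norm v powr p)"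
        using elim by simp
    qed
  qed
qed

definition capped_var :: "real \<Rightarrow> (real \<Rightarrow> 'a::real_normed_vector) \<Rightarrow> real \<Rightarrow> real \<Rightarrow> real" where
  "capped_var p f a b = (SUP ts \<in> {ts. sorted ts \<and> set ts \<subseteq> {a..b}}. chain_sum (capped_incr p f) ts)"

lemma chain_sum_le_capped_var:
  assumes "f \<in> BVp p" "0 \<le> a" "b \<le> 1" "sorted ts" "set ts \<subseteq> {a..b}"
  shows "chain_sum (capped_incr p f) ts \<le> capped_var p f a b"
proof -
  obtain V where V: "\<And>ts. sorted ts \<Longrightarrow> set ts \<subseteq> {0..1} \<Longrightarrow> chain_sum (incr_powr p f) ts \<le> V"
    using assms(1) unfolding BVp_iff by blast
  have "chain_sum (capped_incr p f) us \<le> V" if "sorted us" "set us \<subseteq> {a..b}" for us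
  proof -
    have "chain_sum (capped_incr p f) us \<le> chain_sum (incr_powr p f) us"
      by (rule chain_sum_mono) (simp add: capped_incr_def incr_powr_def)
    also have "\<dots> \<le> V" using that assms(2,3) by (intro V) force+
    finally show ?thesis .
  qed
  then have "bdd_above (chain_sum (capped_incr p f) ` {ts. sorted ts \<and> set ts \<subseteq> {a..b}})"
    by (auto simp: bdd_above_def)
  then show ?thesis unfolding capped_var_def by (intro cSUP_upper) (use assms in auto)
qed

lemma capped_var_least:
  assumes "\<And>ts. sorted ts \<Longrightarrow> set ts \<subseteq> {a..b} \<Longrightarrow> chain_sum (capped_incr p f) ts \<le> V"
  shows "capped_var p f a b \<le> V"
  unfolding capped_var_def by (rule cSUP_least) (use assms in \<open>auto intro: exI[of _ "[]"]\<close>)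

text \<open>Concatenating lists from the two intervals only adds a nonnegative junction term; the
  two suprema are then taken one after the other.\<close>

lemma capped_var_superadditive:
  assumes "f \<in> BVp p" "0 \<le> a" "c \<le> 1" "a \<le> b" "b \<le> c"
  shows "capped_var p f a b + capped_var p f b c \<le> capped_var p f a c"
proof -
  have "capped_var p f a b \<le> capped_var p f a c - capped_var p f b c"
  proof (rule capped_var_least)
    fix us assume us: "sorted us" "set us \<subseteq> {a..b}"
    have "capped_var p f b c \<le> capped_var p f a c - chain_sum (capped_incr p f) us"
    proof (rule capped_var_least)
      fix vs assume vs: "sorted vs" "set vs \<subseteq> {b..c}"
      have "sorted (us @ vs)" using us vs by (force simp: sorted_append)
      moreover have "set (us @ vs) \<subseteq> {a..c}" using us vs assms by force
      ultimately have "chain_sum (capped_incr p f) (us @ vs) \<le> capped_var p f a c"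
        using assms by (intro chain_sum_le_capped_var) auto
      moreover have "chain_sum (capped_incr p f) us + chain_sum (capped_incr p f) vs
          \<le> chain_sum (capped_incr p f) (us @ vs)"
        by (rule chain_sum_append_ge) (rule capped_incr_nonneg)
      ultimately show "chain_sum (capped_incr p f) vs
          \<le> capped_var p f a c - chain_sum (capped_incr p f) us" by linarith
    qed
    then show "chain_sum (capped_incr p f) us \<le> capped_var p f a c - capped_var p f b c"
      by linarith
  qed
  then show ?thesis by linarith
qed

lemma capped_incr_commute: "capped_incr p f s t = capped_incr p f t s"
  by (simp add: capped_incr_def norm_minus_commute add.commute)

text \<open>If a chain begins and ends at small values, attaching \<open>a\<close> and
  \<open>b\<close> to it gives a competitor for \<open>capped_var\<close>. Its two end pairs nearly
  yield \<open>norm (f a) powr p + norm (f b) powr p\<close>, which already covers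
  \<open>capped_incr p f a b\<close>; the chain itself can therefore contribute little more than the
  defect.\<close>

lemma near_zero_limit_le_gap:
  assumes p: "0 < p" and f: "f \<in> BVp p" and ab: "0 \<le> a" "a \<le> b" "b \<le> 1"
  shows "near_zero_limit_le p f a b (2 powr p * (capped_var p f a b - capped_incr p f a b))"
  unfolding near_zero_limit_le_def
proof (intro allI impI)
  fix \<kappa> :: real assume \<kappa>: "\<kappa> > 0"
  \<comment> \<open>Two end pairs lose \<open>\<kappa>'\<close> each, multiplied by
    \<open>2 powr p\<close>, and two junctions cost less than \<open>\<kappa>'\<close> each;
    together this makes \<open>\<kappa>\<close>.\<close>
  define \<kappa>' where "\<kappa>' = \<kappa> / (2 * (2 powr p + 1))"
  have pos: "2 powr p + 1 > 0" by (simp add: add_pos_pos)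
  have "\<kappa> = 2 * (2 powr p + 1) * \<kappa>'"
    using pos by (simp add: \<kappa>'_def)
  then have \<kappa>': "\<kappa>' > 0" "\<kappa> = 2 * 2 powr p * \<kappa>' + 2 * \<kappa>'"
    using \<kappa> pos by (simp add: \<kappa>'_def, simp add: algebra_simps)
  have ge: "capped_incr p f a b \<le> capped_var p f a b"
    using chain_sum_le_capped_var[OF f, of a b "[a, b]"] ab by auto
  show "\<forall>\<^sub>F \<delta> in at_right 0. \<forall>ts. sorted ts \<longrightarrow> set ts \<subseteq> {a..b} \<longrightarrow>
        chain_sum (near_zero_incr p f \<delta>) ts
          \<le> 2 powr p * (capped_var p f a b - capped_incr p f a b) + \<kappa>"
    using eventually_powr_less[OF p \<kappa>'(1)] eventually_at_right_less[of 0]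
      eventually_capped_powr_ge[OF p \<kappa>'(1), of "f a"] eventually_capped_powr_ge[OF p \<kappa>'(1), of "f b"]
  proof eventually_elim
    case (elim \<delta>)
    let ?N = "near_zero_incr p f \<delta>" and ?R = "capped_incr p f"
    have none: "chain_sum ?N us = 0" if "\<forall>x\<in>set us. \<not> norm (f x) \<le> \<delta>" for us
      using that by (induction us rule: induct_list012) (auto simp: near_zero_incr_def)
    have N_le: "chain_sum ?N (us @ vs) \<le> chain_sum ?N us + chain_sum ?N vs + \<delta> powr p" for us vs
      by (rule chain_sum_append_le) (use near_zero_incr_le[OF less_imp_le[OF p] \<open>0 < \<delta>\<close>] in auto)
    show ?case
    proof (intro allI impI)
      fix ts :: "real list" assume ts: "sorted ts" "set ts \<subseteq> {a..b}"
      show "chain_sum ?N ts \<le> 2 powr p * (capped_var p f a b - ?R a b) + \<kappa>"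
      proof (cases "\<exists>x\<in>set ts. norm (f x) \<le> \<delta>")
        case False
        then have "chain_sum ?N ts = 0" using none by blast
        moreover have "0 \<le> 2 powr p * (capped_var p f a b - ?R a b)"
          using ge by simp
        ultimately show ?thesis using \<kappa> by simp
      next
        case True
        then obtain us x vs where 1: "ts = us @ x # vs" "norm (f x) \<le> \<delta>"
          "\<forall>y\<in>set us. \<not> norm (f y) \<le> \<delta>"
          using split_list_first_prop[of ts "\<lambda>x. norm (f x) \<le> \<delta>"] by blast
        then have "\<exists>y\<in>set (x # vs). norm (f y) \<le> \<delta>" by auto
        then obtain ms y ws where 2: "x # vs = ms @ y # ws" "norm (f y) \<le> \<delta>"
          "\<forall>z\<in>set ws. \<not> norm (f z) \<le> \<delta>"
          using split_list_last_prop[of "x # vs" "\<lambda>x. norm (f x) \<le> \<delta>"] by blast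
        \<comment> \<open>\<open>mid\<close> runs from the first to the last point with a value of
          norm at most \<open>\<delta>\<close>. Outside it only the two junction pairs can
          contribute, each at most \<open>\<delta> powr p\<close>.\<close>
        define mid where "mid = ms @ [y]"
        have mid: "mid \<noteq> []" "hd mid = x" "last mid = y"
          using 2(1) by (auto simp: mid_def hd_append) (metis hd_append2 list.sel(1))+
        have ts_eq: "ts = us @ mid @ ws" using 1 2 by (simp add: mid_def)
        have "chain_sum ?N ts \<le> chain_sum ?N mid + 2 * \<delta> powr p"
          using N_le[of us "mid @ ws"] N_le[of mid ws] none[OF 1(3)] none[OF 2(3)]
          unfolding ts_eq by linarith
        moreover have "chain_sum ?N mid \<le> 2 powr p * chain_sum ?R mid"
          unfolding chain_sum_cmult[symmetric]
          by (rule chain_sum_mono) (rule near_zero_incr_le_capped_incr, use p elim in auto)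
        moreover have "chain_sum ?R mid \<le> capped_var p f a b - ?R a b + 2 * \<kappa>'"
        proof -
          have "sorted (a # mid @ [b])" "set (a # mid @ [b]) \<subseteq> {a..b}"
            using ts ab unfolding ts_eq by (auto simp: sorted_append)
          then have "chain_sum ?R (a # mid @ [b]) \<le> capped_var p f a b"
            using ab by (intro chain_sum_le_capped_var[OF f])
          moreover have "chain_sum ?R (a # mid @ [b]) = ?R a x + chain_sum ?R mid + ?R b y"
            using mid by (simp add: chain_sum_Cons chain_sum_append capped_incr_commute[of p f b])
          moreover have "norm (f a) powr p - \<kappa>' \<le> ?R a x" "norm (f b) powr p - \<kappa>' \<le> ?R b y"
            using elim 1(2) 2(2) by (simp_all add: capped_incr_def)
          moreover have "?R a b \<le> norm (f a) powr p + norm (f b) powr p"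
            by (simp add: capped_incr_def)
          ultimately show ?thesis by linarith
        qed
        then have "2 powr p * chain_sum ?R mid
            \<le> 2 powr p * (capped_var p f a b - ?R a b + 2 * \<kappa>')"
          by (intro mult_left_mono) auto
        ultimately show ?thesis using elim(1) \<kappa>'(2) by (simp add: algebra_simps)
      qed
    qed
  qed
qed

text \<open>The defects of the single gaps add up, and superadditivity of \<open>capped_var\<close>
  bounds their sum by the defect of the whole chain.\<close>

lemma near_zero_limit_le_chain:
  assumes p: "0 < p" and f: "f \<in> BVp p"
  shows "sorted (a # ts) \<Longrightarrow> set (a # ts) \<subseteq> {0..1} \<Longrightarrow>
    near_zero_limit_le p f a (last (a # ts))
      (2 powr p * (capped_var p f a (last (a # ts)) - chain_sum (capped_incr p f) (a # ts)))"
proof (induction ts arbitrary: a)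
  case Nil
  have "capped_incr p f a a = 0" by (simp add: capped_incr_def)
  then show ?case using near_zero_limit_le_gap[OF p f, of a a] Nil by simp
next
  case (Cons b ts)
  let ?z = "last (b # ts)"
  have ab: "0 \<le> a" "a \<le> b" "b \<le> 1" "?z \<le> 1" "b \<le> ?z"
    using Cons.prems last_in_set[of "b # ts"] by auto
  have "near_zero_limit_le p f a ?z (2 powr p * (capped_var p f a b - capped_incr p f a b)
      + 2 powr p * (capped_var p f b ?z - chain_sum (capped_incr p f) (b # ts)))"
    using Cons ab by (intro near_zero_limit_le_join[OF p near_zero_limit_le_gap[OF p f]]) auto
  moreover have "2 powr p * (capped_var p f a b - capped_incr p f a b)
      + 2 powr p * (capped_var p f b ?z - chain_sum (capped_incr p f) (b # ts))
    \<le> 2 powr p * (capped_var p f a ?z - chain_sum (capped_incr p f) (a # b # ts))"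
    using capped_var_superadditive[OF f, of a ?z b] ab
    unfolding distrib_left[symmetric] by (intro mult_left_mono) auto
  ultimately have "near_zero_limit_le p f a ?z
      (2 powr p * (capped_var p f a ?z - chain_sum (capped_incr p f) (a # b # ts)))"
    unfolding near_zero_limit_le_def
    by (elim all_forward imp_forward eventually_mono) (auto intro: order_trans)
  then show ?case by simp
qed

lemma near_zero_variation_small:
  assumes p: "0 < p" and f: "f \<in> BVp p"
  shows "near_zero_limit_le p f 0 1 0"
  unfolding near_zero_limit_le_def
proof (intro allI impI)
  fix \<kappa> :: real assume \<kappa>: "\<kappa> > 0"
  \<comment> \<open>After the factor \<open>2 powr p\<close> the defect uses half of
    \<open>\<kappa>\<close>; the other half is the tolerance in the limit statement.\<close>
  define e where "e = \<kappa> / (2 * 2 powr p)"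
  have e: "e > 0" "2 powr p * e = \<kappa> / 2" using \<kappa> by (auto simp: e_def field_simps)
  \<comment> \<open>If there were no such list, \<open>capped_var_least\<close> would bound the
    supremum by itself minus \<open>e\<close>.\<close>
  obtain ts where ts: "sorted ts" "set ts \<subseteq> {0..1}"
    "chain_sum (capped_incr p f) ts > capped_var p f 0 1 - e"
    using capped_var_least[of 0 1 p f "capped_var p f 0 1 - e"] e(1) by force
  let ?us = "0 # ts @ [1]"
  have "sorted ?us" "set ?us \<subseteq> {0..1}" using ts by (auto simp: sorted_append)
  then have lim: "near_zero_limit_le p f 0 1
      (2 powr p * (capped_var p f 0 1 - chain_sum (capped_incr p f) ?us))"
    using near_zero_limit_le_chain[OF p f, of 0 "ts @ [1]"] by simp
  have "chain_sum (capped_incr p f) ts \<le> chain_sum (capped_incr p f) ?us"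
    using chain_sum_append_ge[of "capped_incr p f" "[0]" "ts @ [1]"]
      chain_sum_append_ge[of "capped_incr p f" ts "[1]"]
    by (simp add: capped_incr_nonneg)
  then have "2 powr p * (capped_var p f 0 1 - chain_sum (capped_incr p f) ?us) \<le> 2 powr p * e"
    using ts(3) by (intro mult_left_mono) auto
  then have small: "2 powr p * (capped_var p f 0 1 - chain_sum (capped_incr p f) ?us) + \<kappa> / 2 \<le> 0 + \<kappa>"
    using e(2) by linarith
  have "\<kappa> / 2 > 0" using \<kappa> by simp
  from lim[unfolded near_zero_limit_le_def, rule_format, OF this]
  show "\<forall>\<^sub>F \<delta> in at_right 0. \<forall>ts. sorted ts \<longrightarrow> set ts \<subseteq> {0..1} \<longrightarrow>
        chain_sum (near_zero_incr p f \<delta>) ts \<le> 0 + \<kappa>"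
    by eventually_elim (use small in \<open>blast intro: order_trans\<close>)
qed

section \<open>The hysteresis set and its boundary crossings\<close>

text \<open>The gap between the thresholds \<open>\<delta> / 2\<close> and \<open>\<delta>\<close>
  forces \<open>f\<close> to travel a distance of at least \<open>\<delta> / 2\<close> between an
  entry and an exit, so each such passage uses up near-zero variation.\<close>

definition hysteresis_set :: "(real \<Rightarrow> 'a::real_normed_vector) \<Rightarrow> real \<Rightarrow> real set" where
  "hysteresis_set f \<delta> = {x. \<exists>s\<in>{0..x}. norm (f s) < \<delta> / 2 \<and> (\<forall>r\<in>{s..x}. norm (f r) \<le> \<delta>)}"

definition switches :: "'b set \<Rightarrow> 'b \<Rightarrow> 'b \<Rightarrow> real" where
  "switches C s t = (if s \<in> C \<longleftrightarrow> t \<in> C then 0 else 1)"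

lemma hysteresis_set_norm_le: "x \<in> hysteresis_set f \<delta> \<Longrightarrow> norm (f x) \<le> \<delta>"
  by (auto simp: hysteresis_set_def)

lemma not_hysteresis_set_norm_ge:
  assumes "x \<notin> hysteresis_set f \<delta>" "0 \<le> x" "0 < \<delta>"
  shows "\<delta> / 2 \<le> norm (f x)"
proof (rule ccontr)
  assume "\<not> ?thesis"
  then have "norm (f x) < \<delta> / 2" by simp
  then have "x \<in> hysteresis_set f \<delta>"
    using assms by (auto simp: hysteresis_set_def intro!: bexI[of _ x])
  then show False using assms by simp
qed

text \<open>The point \<open>s\<close> that puts \<open>y\<close> into the set cannot precede
  \<open>x\<close>, since it would then put \<open>x\<close> into the set as well.\<close>

lemma hysteresis_set_enter:
  assumes "x \<notin> hysteresis_set f \<delta>" "y \<in> hysteresis_set f \<delta>" "x \<le> y"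
  obtains w where "x \<le> w" "w \<le> y" "norm (f w) < \<delta> / 2"
proof -
  obtain s where s: "s \<in> {0..y}" "norm (f s) < \<delta> / 2" "\<forall>r\<in>{s..y}. norm (f r) \<le> \<delta>"
    using assms(2) by (auto simp: hysteresis_set_def)
  have "x \<le> s"
  proof (rule ccontr)
    assume "\<not> x \<le> s"
    then have "x \<in> hysteresis_set f \<delta>"
      using s assms(3) by (auto simp: hysteresis_set_def intro!: bexI[of _ s])
    then show False using assms by simp
  qed
  then show ?thesis using s that by auto
qed

lemma hysteresis_set_leave:
  assumes "x \<in> hysteresis_set f \<delta>" "y \<notin> hysteresis_set f \<delta>" "x \<le> y"
  obtains w where "x \<le> w" "w \<le> y" "\<delta> < norm (f w)"
proof -
  obtain s where s: "s \<in> {0..x}" "norm (f s) < \<delta> / 2" "\<forall>r\<in>{s..x}. norm (f r) \<le> \<delta>"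
    using assms(1) by (auto simp: hysteresis_set_def)
  have "s \<in> {0..y}" using s assms by auto
  then obtain w where w: "w \<in> {s..y}" "\<delta> < norm (f w)"
    using assms(2) s(2) by (auto simp: hysteresis_set_def not_le)
  then have "x \<le> w" using s(3) by force
  then show ?thesis using w that by auto
qed

lemma near_zero_incr_crossing:
  assumes "0 \<le> p" "0 < \<delta>"
    and "norm (f s) < \<delta> / 2 \<and> \<delta> < norm (f t) \<or> norm (f t) < \<delta> / 2 \<and> \<delta> < norm (f s)"
  shows "(\<delta> / 2) powr p \<le> near_zero_incr p f \<delta> s t"
proof -
  have "\<delta> / 2 \<le> min \<delta> (norm (f t - f s))"
    using assms norm_triangle_ineq2[of "f t" "f s"] norm_triangle_ineq2[of "f s" "f t"]
    by (auto simp: norm_minus_commute)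
  then have "(\<delta> / 2) powr p \<le> min \<delta> (norm (f t - f s)) powr p"
    using assms by (intro powr_mono2) auto
  then show ?thesis using assms by (auto simp: near_zero_incr_def)
qed

text \<open>Each switch supplies a witness: above \<open>\<delta>\<close> on leaving, below
  \<open>\<delta> / 2\<close> on entering. Switches alternate, so consecutive witnesses form pairs
  worth at least \<open>(\<delta> / 2) powr p\<close>. The condition that ties the first witness to
  \<open>x \<in> C\<close> is what allows the induction to prepend another.\<close>

lemma hysteresis_set_crossings:
  fixes f :: "real \<Rightarrow> 'a::real_normed_vector" and p \<delta> :: real
  assumes p: "0 \<le> p" "0 < \<delta>"
  defines "C \<equiv> hysteresis_set f \<delta>"
  shows "sorted (x # ts) \<Longrightarrow> set (x # ts) \<subseteq> {0..1} \<Longrightarrow>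
    chain_sum (switches C) (x # ts) = 0 \<or>
    (\<exists>w ws. sorted (w # ws) \<and> set (w # ws) \<subseteq> {x..1} \<and>
       (if x \<in> C then \<delta> < norm (f w) else norm (f w) < \<delta> / 2) \<and>
       (\<delta> / 2) powr p * chain_sum (switches C) (x # ts)
          \<le> (\<delta> / 2) powr p + chain_sum (near_zero_incr p f \<delta>) (w # ws))"
proof (induction ts arbitrary: x)
  case Nil
  then show ?case by simp
next
  case (Cons y ts)
  let ?k = "(\<delta> / 2) powr p" and ?S = "chain_sum (switches C)" and ?N = "chain_sum (near_zero_incr p f \<delta>)"
  have xy: "x \<le> y" "y \<le> 1" using Cons.prems by auto
  have IH: "?S (y # ts) = 0 \<or>
    (\<exists>w ws. sorted (w # ws) \<and> set (w # ws) \<subseteq> {y..1} \<and>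
       (if y \<in> C then \<delta> < norm (f w) else norm (f w) < \<delta> / 2) \<and>
       ?k * ?S (y # ts) \<le> ?k + ?N (w # ws))"
    by (rule Cons.IH) (use Cons.prems in auto)
  show ?case
  proof (cases "x \<in> C \<longleftrightarrow> y \<in> C")
    case True
    then have "?S (x # y # ts) = ?S (y # ts)" by (simp add: switches_def)
    moreover have "set ws \<subseteq> {y..1} \<Longrightarrow> set ws \<subseteq> {x..1}" for ws using xy by force
    ultimately show ?thesis using IH xy unfolding True by (elim disj_forward ex_forward) auto
  next
    case False
    then have S: "?S (x # y # ts) = 1 + ?S (y # ts)" by (simp add: switches_def)
    obtain u where u: "x \<le> u" "u \<le> y" "if x \<in> C then \<delta> < norm (f u) else norm (f u) < \<delta> / 2"
      using False xy hysteresis_set_enter[of x f \<delta> y] hysteresis_set_leave[of x f \<delta> y]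
      unfolding C_def by metis
    from IH show ?thesis
    proof
      \<comment> \<open>A single switch has one witness and no pair of witnesses; this off-by-one is
        the extra \<open>?k\<close> in the bound.\<close>
      assume "?S (y # ts) = 0"
      then show ?thesis using u xy S by (intro disjI2 exI[of _ u] exI[of _ "[]"]) auto
    next
      assume "\<exists>w ws. sorted (w # ws) \<and> set (w # ws) \<subseteq> {y..1} \<and>
       (if y \<in> C then \<delta> < norm (f w) else norm (f w) < \<delta> / 2) \<and>
       ?k * ?S (y # ts) \<le> ?k + ?N (w # ws)"
      then obtain w ws where w: "sorted (w # ws)" "set (w # ws) \<subseteq> {y..1}"
        "if y \<in> C then \<delta> < norm (f w) else norm (f w) < \<delta> / 2"
        "?k * ?S (y # ts) \<le> ?k + ?N (w # ws)" by blast
      \<comment> \<open>Membership of \<open>x\<close> and \<open>y\<close> differs, so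
        \<open>u\<close> and \<open>w\<close> lie on opposite sides of the annulus.\<close>
      have "?k \<le> near_zero_incr p f \<delta> u w"
        by (rule near_zero_incr_crossing) (use p False u w in \<open>auto split: if_splits\<close>)
      then have "?k * ?S (x # y # ts) \<le> ?k + ?N (u # w # ws)"
        using w(4) unfolding S by (simp add: distrib_left)
      moreover have "sorted (u # w # ws)" "set (u # w # ws) \<subseteq> {x..1}"
        using u w xy by force+
      ultimately show ?thesis using u(3)
        by (intro disjI2 exI[of _ u] exI[of _ "w # ws"] conjI)
    qed
  qed
qed

lemma hysteresis_set_switches_le:
  assumes p: "0 \<le> p" "0 < \<delta>"
    and \<kappa>: "\<And>ts. sorted ts \<Longrightarrow> set ts \<subseteq> {0..1} \<Longrightarrow> chain_sum (near_zero_incr p f \<delta>) ts \<le> \<kappa>"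
    and ts: "sorted ts" "set ts \<subseteq> {0..1}"
  shows "\<delta> powr p * chain_sum (switches (hysteresis_set f \<delta>)) ts \<le> \<delta> powr p + 2 powr p * \<kappa>"
proof -
  let ?S = "chain_sum (switches (hysteresis_set f \<delta>)) ts"
  have \<kappa>0: "0 \<le> \<kappa>" using \<kappa>[of "[]"] by simp
  have "?S = 0 \<or> (\<delta> / 2) powr p * ?S \<le> (\<delta> / 2) powr p + \<kappa>"
  proof (cases ts)
    case (Cons x us)
    have "set ws \<subseteq> {x..1} \<Longrightarrow> set ws \<subseteq> {0..1}" for ws using Cons ts by force
    then have N: "sorted ws \<Longrightarrow> set ws \<subseteq> {x..1} \<Longrightarrow> chain_sum (near_zero_incr p f \<delta>) ws \<le> \<kappa>" for ws
      using \<kappa> by blast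
    from ts have "sorted (x # us)" "set (x # us) \<subseteq> {0..1}" by (simp_all add: Cons)
    from hysteresis_set_crossings[OF p this, of f] show ?thesis
    proof (elim disjE exE conjE)
      fix w ws
      assume "sorted (w # ws)" "set (w # ws) \<subseteq> {x..1}"
        and *: "(\<delta> / 2) powr p * chain_sum (switches (hysteresis_set f \<delta>)) (x # us)
          \<le> (\<delta> / 2) powr p + chain_sum (near_zero_incr p f \<delta>) (w # ws)"
      then have "chain_sum (near_zero_incr p f \<delta>) (w # ws) \<le> \<kappa>" by (intro N)
      then show ?thesis using * unfolding Cons by linarith
    qed (simp add: Cons)
  qed simp
  then have "(\<delta> / 2) powr p * ?S \<le> (\<delta> / 2) powr p + \<kappa>" using \<kappa>0 by auto
  \<comment> \<open>The factor \<open>2 powr p\<close> turns the crossing height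
    \<open>\<delta> / 2\<close> into \<open>\<delta>\<close>.\<close>
  then have "2 powr p * ((\<delta> / 2) powr p * ?S) \<le> 2 powr p * ((\<delta> / 2) powr p + \<kappa>)"
    by (intro mult_left_mono) auto
  moreover have "2 powr p * (\<delta> / 2) powr p = \<delta> powr p"
    using p by (simp flip: powr_mult)
  ultimately show ?thesis by (simp add: distrib_left flip: mult.assoc)
qed

section \<open>Norm bounds for corrections supported on the hysteresis set\<close>

text \<open>Pairs inside the set are controlled by increments of \<open>f\<close> near the origin
  and pairs outside contribute 0. Pairs across the boundary jump by at most
  \<open>2 * \<delta>\<close>, and the crossing bound limits their number.\<close>

lemma chain_sum_hysteresis_le:
  fixes f :: "real \<Rightarrow> 'a::real_normed_vector" and h :: "real \<Rightarrow> 'b::real_normed_vector"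
  assumes p: "0 \<le> p" and \<delta>: "0 < \<delta>"
    and \<kappa>: "\<And>ts. sorted ts \<Longrightarrow> set ts \<subseteq> {0..1} \<Longrightarrow> chain_sum (near_zero_incr p f \<delta>) ts \<le> \<kappa>"
    and out: "\<And>x. x \<notin> hysteresis_set f \<delta> \<Longrightarrow> h x = 0"
    and le: "\<And>x. x \<in> hysteresis_set f \<delta> \<Longrightarrow> norm (h x) \<le> 2 * \<delta>"
    and lip: "\<And>s t. s \<in> hysteresis_set f \<delta> \<Longrightarrow> t \<in> hysteresis_set f \<delta> \<Longrightarrow>
                 norm (h t - h s) \<le> 3 * norm (f t - f s)"
    and ts: "sorted ts" "set ts \<subseteq> {0..1}"
  shows "chain_sum (incr_powr p h) ts \<le> (6 powr p + 4 powr p) * \<kappa> + (2 * \<delta>) powr p"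
proof -
  let ?C = "hysteresis_set f \<delta>"
  have incr: "incr_powr p h s t \<le> 6 powr p * near_zero_incr p f \<delta> s t + (2 * \<delta>) powr p * switches ?C s t"
    for s t
  proof (cases "s \<in> ?C \<longleftrightarrow> t \<in> ?C")
    case True
    show ?thesis
    proof (cases "s \<in> ?C")
      case False
      then have "incr_powr p h s t = 0" using True out by (simp add: incr_powr_def)
      then show ?thesis using near_zero_incr_nonneg[of p f \<delta> s t] by (simp add: switches_def)
    next
      case s: True
      then have fs: "norm (f s) \<le> \<delta>" "norm (f t) \<le> \<delta>" using True hysteresis_set_norm_le by auto
      then have "norm (f t - f s) \<le> 2 * \<delta>" using norm_triangle_ineq4[of "f t" "f s"] by linarith
      \<comment> \<open>Both values of \<open>f\<close> have norm at most \<open>\<delta>\<close>,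
        so the increment is at most twice its truncation at \<open>\<delta>\<close>; this doubles
        the constant 3 to 6.\<close>
      then have "norm (h t - h s) \<le> 6 * min \<delta> (norm (f t - f s))"
        using lip[of s t] s True norm_ge_zero[of "f t - f s"] unfolding min_def by (smt (verit))
      then have "incr_powr p h s t \<le> (6 * min \<delta> (norm (f t - f s))) powr p"
        unfolding incr_powr_def using p by (intro powr_mono2) auto
      also have "\<dots> = 6 powr p * near_zero_incr p f \<delta> s t"
        using fs \<delta> by (simp add: near_zero_incr_def powr_mult)
      finally show ?thesis using True by (simp add: switches_def)
    qed
  next
    case False
    then have "norm (h t - h s) \<le> 2 * \<delta>" using out le[of s] le[of t] by auto
    then have "incr_powr p h s t \<le> (2 * \<delta>) powr p"
      unfolding incr_powr_def using p by (intro powr_mono2) auto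
    then show ?thesis
      using False near_zero_incr_nonneg[of p f \<delta> s t] by (simp add: switches_def add_increasing)
  qed
  have "chain_sum (incr_powr p h) ts
      \<le> chain_sum (\<lambda>s t. 6 powr p * near_zero_incr p f \<delta> s t + (2 * \<delta>) powr p * switches ?C s t) ts"
    by (rule chain_sum_mono) (rule incr)
  also have "\<dots> = 6 powr p * chain_sum (near_zero_incr p f \<delta>) ts
      + 2 powr p * (\<delta> powr p * chain_sum (switches ?C) ts)"
    using \<delta> by (simp add: chain_sum_cmult chain_sum_add powr_mult)
  also have "\<dots> \<le> 6 powr p * \<kappa> + 2 powr p * (\<delta> powr p + 2 powr p * \<kappa>)"
    using \<kappa>[OF ts] hysteresis_set_switches_le[OF p \<delta> \<kappa> ts]
    by (intro add_mono mult_left_mono) auto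
  also have "\<dots> = (6 powr p + 4 powr p) * \<kappa> + (2 * \<delta>) powr p"
  \<comment> \<open>\<open>4 powr p\<close> combines the jump size \<open>2 * \<delta>\<close> with
    the factor \<open>2 powr p\<close> of the crossing bound.\<close>
  proof -
    have "2 powr p * 2 powr p = (4::real) powr p" by (simp flip: powr_mult)
    then show ?thesis using \<delta> by (simp add: powr_mult distrib_left distrib_right flip: mult.assoc)
  qed
  finally show ?thesis .
qed

lemma bvp_norm_le:
  assumes p: "0 < p"
    and sup: "\<And>x. x \<in> {0..1} \<Longrightarrow> norm (h x) \<le> a"
    and V: "\<And>ts. sorted ts \<Longrightarrow> set ts \<subseteq> {0..1} \<Longrightarrow> chain_sum (incr_powr p h) ts \<le> V"
  shows "bvp_norm p h \<le> a + V powr (1 / p)"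
proof -
  have "(SUP x \<in> {0..1}. norm (h x)) \<le> a" by (rule cSUP_least) (use sup in auto)
  moreover have "real_of_ereal (pvar p h) \<le> V"
    using pvar_le[OF V] pvar_nonneg[of p h] by (cases "pvar p h") auto
  then have "real_of_ereal (pvar p h) powr (1 / p) \<le> V powr (1 / p)"
    using p pvar_nonneg[of p h] by (intro powr_mono2) (auto simp: real_of_ereal_pos)
  ultimately show ?thesis by (simp add: bvp_norm_def)
qed

section \<open>Construction of the nearby nondegenerate pair\<close>

lemma nondegenerate_factorization_nearby:
  fixes F G :: "real \<Rightarrow> 'a::real_normed_field"
  assumes p: "0 < p" and \<epsilon>: "0 < \<epsilon>" and FG: "F \<in> BVp p" "G \<in> BVp p"
  shows "\<exists>F1 G1. F1 \<in> BVp p \<and> G1 \<in> BVp p \<and> jointly_nondegenerate F1 G1 \<and>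
               (\<forall>x\<in>{0..1}. F x * G x = F1 x * G1 x) \<and>
               bvp_norm p (\<lambda>x. F x - F1 x) < \<epsilon> \<and> bvp_norm p (\<lambda>x. G x - G1 x) < \<epsilon>"
proof -
  define f where "f x = (F x, G x)" for x
  have f: "f \<in> BVp p"
    using BVp_dominated[OF _ FG, of f] p by (simp add: f_def norm_Pair sqrt_sum_squares_le_sum)
  \<comment> \<open>The variation part of the norm gets
    \<open>\<tau> powr (1 / p) = \<epsilon> / 2\<close>, with \<open>\<tau>\<close> shared equally
    between near-zero increments and boundary jumps. The supremum part stays below the other half
    because \<open>\<delta> < \<epsilon> / 4\<close>.\<close>
  define \<tau> where "\<tau> = (\<epsilon> / 2) powr p"
  define \<kappa> where "\<kappa> = \<tau> / 2 / (6 powr p + 4 powr p)"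
  have pos: "6 powr p + 4 powr p > (0::real)" by (simp add: add_pos_pos)
  have \<tau>: "\<tau> > 0" using \<epsilon> by (simp add: \<tau>_def)
  have \<kappa>: "\<kappa> > 0" "(6 powr p + 4 powr p) * \<kappa> = \<tau> / 2" using \<tau> pos
    by (simp add: \<kappa>_def, metis \<kappa>_def less_irrefl nonzero_mult_div_cancel_left times_divide_eq_right)
  have "\<tau> / 2 / 2 powr p > 0" "\<epsilon> / 4 > 0" using \<tau> \<epsilon> by simp_all
  from near_zero_variation_small[OF p f, unfolded near_zero_limit_le_def, rule_format, OF \<kappa>(1)]
    eventually_powr_less[OF p this(1)] eventually_at_right_less[of 0]
    order_tendstoD(2)[OF tendsto_ident_at this(2), of "{0<..}"]
  have "\<forall>\<^sub>F \<delta> in at_right 0. (\<forall>ts. sorted ts \<longrightarrow> set ts \<subseteq> {0..1} \<longrightarrow>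
        chain_sum (near_zero_incr p f \<delta>) ts \<le> 0 + \<kappa>) \<and> \<delta> powr p < \<tau> / 2 / 2 powr p \<and> 0 < \<delta> \<and> \<delta> < \<epsilon> / 4"
    by eventually_elim blast
  then obtain \<delta> where near: "\<And>ts. sorted ts \<Longrightarrow> set ts \<subseteq> {0..1} \<Longrightarrow>
        chain_sum (near_zero_incr p f \<delta>) ts \<le> \<kappa>"
    and \<delta>: "\<delta> powr p < \<tau> / 2 / 2 powr p" "0 < \<delta>" "\<delta> < \<epsilon> / 4"
    using eventually_happens'[OF trivial_limit_at_right_real] by force
  have \<delta>p: "(2 * \<delta>) powr p < \<tau> / 2"
    using \<delta>(1,2) by (simp add: powr_mult field_simps)
  define C where "C = hysteresis_set f \<delta>"
  define d :: 'a where "d = of_real \<delta>"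
  have d: "d \<noteq> 0" "norm d = \<delta>" using \<delta> by (auto simp: d_def)
  \<comment> \<open>On \<open>C\<close> these corrections produce
    \<open>F1 x = F x * G x / d\<close> and \<open>G1 x = d\<close>, which preserves the
    product.\<close>
  define HF where "HF x = (if x \<in> C then F x * (1 - G x / d) else 0)" for x
  define HG where "HG x = (if x \<in> C then G x - d else 0)" for x
  define F1 where "F1 x = F x - HF x" for x
  define G1 where "G1 x = G x - HG x" for x
  have comp: "norm (F t - F s) \<le> norm (f t - f s)" "norm (G t - G s) \<le> norm (f t - f s)" for s t
    by (simp_all add: f_def norm_Pair real_le_rsqrt)
  have inC: "norm (F x) \<le> \<delta>" "norm (G x) \<le> \<delta>" if "x \<in> C" for x
  proof -
    have "norm (f x) \<le> \<delta>" using that hysteresis_set_norm_le by (simp add: C_def)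
    moreover have "norm (F x) \<le> norm (f x)" "norm (G x) \<le> norm (f x)"
      by (simp_all add: f_def norm_Pair real_le_rsqrt)
    ultimately show "norm (F x) \<le> \<delta>" "norm (G x) \<le> \<delta>" by linarith+
  qed
  have G_d: "norm (G x / d) \<le> 1" "norm (1 - G x / d) \<le> 2" if "x \<in> C" for x
  proof -
    show "norm (G x / d) \<le> 1" using inC(2)[OF that] d \<delta> by (simp add: norm_divide)
    then show "norm (1 - G x / d) \<le> 2" using norm_triangle_ineq4[of 1 "G x / d"] by simp
  qed
  have HF_le: "norm (HF x) \<le> 2 * \<delta>" for x
  proof (cases "x \<in> C")
    case True
    then have "norm (HF x) \<le> \<delta> * 2"
      unfolding HF_def by (simp add: norm_mult) (intro mult_mono inC G_d; use \<delta> in simp)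
    then show ?thesis by simp
  qed (use \<delta> in \<open>simp add: HF_def\<close>)
  have HG_le: "norm (HG x) \<le> 2 * \<delta>" for x
    using inC(2)[of x] norm_triangle_ineq4[of "G x" d] d \<delta> by (auto simp: HG_def)
  have HF_lip: "norm (HF t - HF s) \<le> 3 * norm (f t - f s)" if "s \<in> C" "t \<in> C" for s t
  proof -
    \<comment> \<open>A discrete product rule: the cofactors \<open>1 - G t / d\<close> and
      \<open>F s / d\<close> have norms at most 2 and 1, which gives the constant 3.\<close>
    have "HF t - HF s = (F t - F s) * (1 - G t / d) - F s / d * (G t - G s)"
      using that d by (simp add: HF_def field_simps)
    also have "norm \<dots> \<le> norm (F t - F s) * norm (1 - G t / d) + norm (F s / d) * norm (G t - G s)"
      by (rule order_trans[OF norm_triangle_ineq4]) (simp only: norm_mult order_refl)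
    also have "\<dots> \<le> norm (f t - f s) * 2 + 1 * norm (f t - f s)"
      using that inC d \<delta> by (intro add_mono mult_mono comp G_d) (auto simp: norm_divide)
    finally show ?thesis by simp
  qed
  have HG_lip: "norm (HG t - HG s) \<le> 3 * norm (f t - f s)" if "s \<in> C" "t \<in> C" for s t
    using that comp(2)[of t s] by (simp add: HG_def) (smt (verit) norm_ge_zero)
  have small: "h \<in> BVp p \<and> bvp_norm p h < \<epsilon>"
    if h: "\<And>x. x \<notin> C \<Longrightarrow> h x = 0" "\<And>x. norm (h x) \<le> 2 * \<delta>"
      "\<And>s t. s \<in> C \<Longrightarrow> t \<in> C \<Longrightarrow> norm (h t - h s) \<le> 3 * norm (f t - f s)"
    for h :: "real \<Rightarrow> 'a"
  proof -
    have V: "chain_sum (incr_powr p h) ts \<le> \<tau>" if ts: "sorted ts" "set ts \<subseteq> {0..1}" for ts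
    proof -
      have "chain_sum (incr_powr p h) ts \<le> (6 powr p + 4 powr p) * \<kappa> + (2 * \<delta>) powr p"
        by (rule chain_sum_hysteresis_le[OF less_imp_le[OF p] \<delta>(2) near])
          (use h ts in \<open>auto simp: C_def\<close>)
      then show ?thesis using \<kappa>(2) \<delta>p by linarith
    qed
    have "bvp_norm p h \<le> 2 * \<delta> + \<tau> powr (1 / p)"
      by (rule bvp_norm_le[OF p]) (use h V in auto)
    also have "\<tau> powr (1 / p) = \<epsilon> / 2" using p \<epsilon> by (simp add: \<tau>_def powr_powr)
    finally have "bvp_norm p h < \<epsilon>" using \<delta>(3) by linarith
    then show ?thesis using V unfolding BVp_iff by blast
  qed
  have HF: "HF \<in> BVp p" "bvp_norm p HF < \<epsilon>"
    using small[of HF] HF_le HF_lip by (auto simp: HF_def)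
  have HG: "HG \<in> BVp p" "bvp_norm p HG < \<epsilon>"
    using small[of HG] HG_le HG_lip by (auto simp: HG_def)
  have diff: "norm (a - b - (a' - b')) \<le> norm (a - a') + norm (b - b')" for a b a' b' :: 'a
    using norm_triangle_ineq4[of "a - a'" "b - b'"] by (simp add: algebra_simps)
  have "F1 \<in> BVp p" "G1 \<in> BVp p"
    using BVp_dominated[OF less_imp_le[OF p] FG(1) HF(1), of F1]
      BVp_dominated[OF less_imp_le[OF p] FG(2) HG(1), of G1] diff
    by (simp_all add: F1_def G1_def)
  moreover have "jointly_nondegenerate F1 G1"
  proof -
    \<comment> \<open>On \<open>C\<close> the second factor alone has norm \<open>\<delta>\<close>;
      off \<open>C\<close> the pair is unchanged and \<open>f\<close> has norm at least
      \<open>\<delta> / 2\<close>.\<close>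
    have "\<delta> / 2 \<le> norm (F1 x) + norm (G1 x)" if "x \<in> {0..1}" for x
    proof (cases "x \<in> C")
      case True
      then show ?thesis using d \<delta> by (simp add: G1_def HG_def add_increasing)
    next
      case False
      then have "\<delta> / 2 \<le> norm (f x)"
        using not_hysteresis_set_norm_ge that \<delta> by (auto simp: C_def)
      also have "norm (f x) \<le> norm (F x) + norm (G x)"
        by (simp add: f_def norm_Pair sqrt_sum_squares_le_sum)
      finally show ?thesis using False by (simp add: F1_def G1_def HF_def HG_def)
    qed
    then have "\<delta> / 2 \<le> (INF x \<in> {0..1}. norm (F1 x) + norm (G1 x))"
      by (intro cINF_greatest) auto
    then show ?thesis using \<delta> by (simp add: jointly_nondegenerate_def)
  qed
  moreover have "\<forall>x\<in>{0..1}. F x * G x = F1 x * G1 x"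
    using d by (auto simp: F1_def G1_def HF_def HG_def field_simps)
  moreover have "(\<lambda>x. F x - F1 x) = HF" "(\<lambda>x. G x - G1 x) = HG"
    by (auto simp: F1_def G1_def)
  ultimately show ?thesis using HF HG by (intro exI[of _ F1] exI[of _ G1]) simp
qed

theorem theorem4p3:
  fixes p :: real
  assumes "1 \<le> p"
  shows "(\<forall>\<epsilon>>0. \<forall>F G :: real \<Rightarrow> real. F \<in> BVp p \<and> G \<in> BVp p \<longrightarrow>
            (\<exists>F1 G1. F1 \<in> BVp p \<and> G1 \<in> BVp p \<and> jointly_nondegenerate F1 G1 \<and>
               (\<forall>x\<in>{0..1}. F x * G x = F1 x * G1 x) \<and>
               bvp_norm p (\<lambda>x. F x - F1 x) < \<epsilon> \<and> bvp_norm p (\<lambda>x. G x - G1 x) < \<epsilon>))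
       \<and> (\<forall>\<epsilon>>0. \<forall>F G :: real \<Rightarrow> complex. F \<in> BVp p \<and> G \<in> BVp p \<longrightarrow>
            (\<exists>F1 G1. F1 \<in> BVp p \<and> G1 \<in> BVp p \<and> jointly_nondegenerate F1 G1 \<and>
               (\<forall>x\<in>{0..1}. F x * G x = F1 x * G1 x) \<and>
               bvp_norm p (\<lambda>x. F x - F1 x) < \<epsilon> \<and> bvp_norm p (\<lambda>x. G x - G1 x) < \<epsilon>))"
proof -
  \<comment> \<open>The real and the complex statement are both instances of the result for normed
    fields.\<close>
  have "0 < p" using assms by simp
  then show ?thesis by (intro conjI allI impI nondegenerate_factorization_nearby) auto
qed

end
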